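(* Let $T$ and $T'$ be trees of respective orders $n$ and $n'$, where $2\le n \leq n'$. Then the following holds. (i) If $n=n'$, then $\nabla(T \,\square\, T')=n-1$ if and only if at least one of $T\cong S_n$ and $T'\cong S_{n'}$ holds. (ii) If $n < n'$, then $\nabla(T \,\square\, T')=n-1$ if and only if $T'\cong S_{n'}$ (and $T$ is arbitrary).
   Context: The order of a graph is its number of vertices. $S_n$ denotes the star $K_{1,n-1}$ on $n$ vertices, and $\cong$ denotes graph isomorphism. A decycling set of a graph $G$ is a set $S\subseteq V(G)$ such that the subgraph of $G$ induced by $V(G)\setminus S$ is a forest (contains no cycle). The decycling number $\nabla(G)$ is the minimum cardinality of a decycling set of $G$. The Cartesian product $G \,\square\, H$ has vertex set $V(G)\times V(H)$, and two vertices $(g,h)$ and $(g',h')$ are adjacent if either $g=g'$ and $hh'\in E(H)$, or $gg'\in E(G)$ and $h=h'$. *)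

theory Defs
  imports "Graph_Theory.Graph_Theory"
begin

text \<open>
  A finite simple graph is a \<^locale>\<open>graph\<close>: a finite loop-free digraph without parallel arcs and
  with symmetric adjacency, so every edge is represented by two opposite arcs. Since
  \<^const>\<open>pre_digraph.cycle\<close> then also covers the walk u, v, u along a single edge,
  \<^const>\<open>forest\<close> and \<^const>\<open>tree\<close> are not the undirected notions. In a \<^locale>\<open>graph\<close>, the
  cycles of length at least 3 are exactly the undirected cycles.
\<close>

definition undirected_forest :: "('a, 'b) pre_digraph \<Rightarrow> bool" where
  "undirected_forest G \<longleftrightarrow> graph G \<and> \<not> (\<exists>p. pre_digraph.cycle G p \<and> 3 \<le> length p)"

definition undirected_tree :: "('a, 'b) pre_digraph \<Rightarrow> bool" where
  "undirected_tree G \<longleftrightarrow> undirected_forest G \<and> Digraph_Component.connected G"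

definition decycling_set :: "('a, 'b) pre_digraph \<Rightarrow> 'a set \<Rightarrow> bool" where
  "decycling_set G S \<longleftrightarrow> S \<subseteq> verts G \<and> undirected_forest (G \<restriction> (verts G - S))"

definition decycling_number :: "('a, 'b) pre_digraph \<Rightarrow> nat"  (\<open>\<nabla>\<close>) where
  "\<nabla> G = Min (card ` {S. decycling_set G S})"

text \<open>
  For a finite simple graph the set of cardinalities above is finite and nonempty, so its minimum is
  meaningful; see \<open>decycling_number_attained\<close> and \<open>decycling_number_le\<close> below.
\<close>

abbreviation graph_iso :: "('a, 'b) pre_digraph \<Rightarrow> ('c, 'd) pre_digraph \<Rightarrow> bool"
    (infix \<open>\<cong>\<close> 50) where
  "G \<cong> H \<equiv> digraph_iso G H"

text \<open>The star on n vertices, with centre 0 and leaves 1, ..., n - 1, where n is at least 1.\<close>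

definition star :: "nat \<Rightarrow> nat pair_pre_digraph" where
  "star n = \<lparr> pverts = {..<n}, parcs = {0} \<times> {1..<n} \<union> {1..<n} \<times> {0} \<rparr>"

definition cartesian_product ::
  "'a pair_pre_digraph \<Rightarrow> 'b pair_pre_digraph \<Rightarrow> ('a \<times> 'b) pair_pre_digraph"
    (infixl \<open>\<box>\<close> 70) where
  "G \<box> H = \<lparr> pverts = pverts G \<times> pverts H,
     parcs = {((g, h), (g', h')) | g h g' h'.
       g \<in> pverts G \<and> g = g' \<and> (h, h') \<in> parcs H \<or>
       (g, g') \<in> parcs G \<and> h \<in> pverts H \<and> h = h'} \<rparr>"


lemma star_complete_bipartite:
  assumes "1 \<le> n"
  shows "complete_bipartite_digraph 1 (n - 1) (with_proj (star n))"
  unfolding complete_bipartite_digraph_pair_def using assms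
  by (intro conjI exI[of _ "{0}"] exI[of _ "{1..<n}"]) (auto simp: star_def)

lemma pair_graph_cartesian_product:
  assumes "pair_graph G" "pair_graph H"
  shows "pair_graph (G \<box> H)"
proof -
  interpret G: pair_graph G by fact
  interpret H: pair_graph H by fact
  have sub: "parcs (G \<box> H) \<subseteq> (pverts G \<times> pverts H) \<times> (pverts G \<times> pverts H)"
    by (auto simp: cartesian_product_def dest: G.wellformed' H.wellformed')
  have fin: "finite (pverts G)" "finite (pverts H)"
    by (rule G.pair_finite_verts, rule H.pair_finite_verts)
  show ?thesis
  proof unfold_locales
    show "symmetric (with_proj (G \<box> H))"
      by (auto simp: symmetric_def cartesian_product_def
               intro!: symI dest: G.arcs_symmetric H.arcs_symmetric)
  next
    show "finite (parcs (G \<box> H))" using sub fin by (auto intro: finite_subset)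
  next
    fix e assume "e \<in> parcs (G \<box> H)"
    then show "fst e \<noteq> snd e"
      by (auto simp: cartesian_product_def dest: G.no_loops' H.no_loops')
  qed (use sub fin in \<open>auto simp: cartesian_product_def dest: G.wellformed' H.wellformed'\<close>)
qed

context graph
begin

lemma decycling_set_verts: "decycling_set G (verts G)"
proof -
  have "induced_subgraph (G \<restriction> {}) G" by (rule induced_induce) simp
  then have "graph (G \<restriction> {})"
    using digraphI_induced induced_graph_imp_symmetric sym_arcs digraph.graphI by metis
  moreover have "\<not> pre_digraph.cycle (G \<restriction> {}) p" for p
    by (auto simp: pre_digraph.cycle_def pre_digraph.awalk_def)
  ultimately show ?thesis by (simp add: decycling_set_def undirected_forest_def)
qed

lemma finite_card_decycling_sets: "finite (card ` {S. decycling_set G S})"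
proof -
  have "{S. decycling_set G S} \<subseteq> Pow (verts G)" by (auto simp: decycling_set_def)
  then show ?thesis by (meson finite_Pow_iff finite_imageI finite_subset finite_verts)
qed

lemma decycling_number_attained: "\<exists>S. decycling_set G S \<and> card S = \<nabla> G"
proof -
  have "\<nabla> G \<in> card ` {S. decycling_set G S}"
    unfolding decycling_number_def
    using finite_card_decycling_sets decycling_set_verts by (intro Min_in) auto
  then show ?thesis by auto
qed

lemma decycling_number_le: "decycling_set G S \<Longrightarrow> \<nabla> G \<le> card S"
  unfolding decycling_number_def using finite_card_decycling_sets by (intro Min_le) auto

end

end

theory Submission
  imports Defs
begin

text \<open>
  Call the sets \<open>{t} \<times> V(T')\<close> rows and the sets \<open>V(T) \<times> {t'}\<close> columns of \<open>T \<box> T'\<close>. Each row is a copy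
  of \<open>T'\<close> and each column a copy of \<open>T\<close>. If a set \<open>S\<close> of vertices misses two rows and two columns,
  then suitable paths along these four lines close up to a rectangle, which is a cycle avoiding
  \<open>S\<close>. So a decycling set meets all rows but at most one, or all columns but at most one
  (\<open>decycling_set_meets_fibres\<close>); there are \<open>n\<close> rows and
  \<open>n' \<ge> n\<close> columns, so it has at least \<open>n - 1\<close> elements.

  Suppose that a decycling set \<open>S\<close> has exactly \<open>n - 1\<close> elements and misses at most one row. Then it
  misses exactly one row, and it has exactly one element in every other row. Let \<open>t\<^sub>0\<close> be the missed
  row, let \<open>t\<^sub>1\<close> be a neighbour of \<open>t\<^sub>0\<close>, and let \<open>(t\<^sub>1, a)\<close> be the element of \<open>S\<close> in row \<open>t\<^sub>1\<close>. An edge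
  \<open>xy\<close> of \<open>T'\<close> that avoids \<open>a\<close> would give the 4-cycle on \<open>{t\<^sub>0, t\<^sub>1} \<times> {x, y}\<close>, which avoids \<open>S\<close>. So
  every edge of \<open>T'\<close> contains \<open>a\<close>, which means that \<open>T'\<close> is a star
  (\<open>star_centre_if_decycling_set\<close>). If \<open>S\<close> misses two rows, then it meets at least \<open>n' - 1\<close>
  columns, which forces \<open>n = n'\<close>, and the same argument with the factors exchanged shows that
  \<open>T\<close> is a star.

  Conversely, let \<open>T'\<close> be a star with centre \<open>a\<close>. Deleting all but one vertex \<open>(v, a)\<close> of the central
  column leaves disjoint copies of the tree \<open>T\<close>, one for each leaf of \<open>T'\<close>, and the vertex
  \<open>(v, a)\<close>, which is joined to each copy by a single edge. This is a forest
  (\<open>decycling_set_if_star_centre\<close>).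

  Cycles are handled throughout by means of vertex sets: a finite graph contains a cycle if and
  only if some nonempty set of vertices induces a subgraph of minimum degree at least two
  (\<open>undirected_forest_iff\<close>). Exhibiting or excluding such a set needs only adjacency, without
  walks in the product.
\<close>

section \<open>Forests and induced subgraphs of minimum degree two\<close>

definition min_degree_two :: "('a \<times> 'a) set \<Rightarrow> 'a set \<Rightarrow> bool" where
  "min_degree_two R W \<longleftrightarrow> W \<noteq> {} \<and>
     (\<forall>w\<in>W. \<exists>x\<in>W. \<exists>y\<in>W. x \<noteq> y \<and> (w, x) \<in> R \<and> (w, y) \<in> R)"

lemma min_degree_twoI:
  assumes "u \<in> W"
    and "\<And>w. w \<in> W \<Longrightarrow> \<exists>x\<in>W. \<exists>y\<in>W. x \<noteq> y \<and> (w, x) \<in> R \<and> (w, y) \<in> R"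
  shows "min_degree_two R W"
  using assms unfolding min_degree_two_def by blast

lemma (in pair_wf_digraph) awalk_vwalk_arcs:
  assumes "vwalk xs (with_proj G)"
  shows "awalk (hd xs) (vwalk_arcs xs) (last xs) \<and> awalk_verts (hd xs) (vwalk_arcs xs) = xs"
  using assms
  by (induct rule: vwalk_induct) (auto simp: awalk_Nil_iff awalk_Cons_iff)

text \<open>
  The end of a longest path inside \<open>W\<close> has a neighbour in \<open>W\<close> other than its predecessor; by
  maximality this neighbour lies on the path, which closes a cycle. One exceptional vertex \<open>v\<close> of
  degree one is harmless, because the path can be started at \<open>v\<close> and extended at its other end only.
  This form serves for the copies of a tree that hang from a common vertex.
\<close>

lemma (in pair_graph) cycle_if_min_degree_two_except:
  assumes "W \<subseteq> pverts G" "W \<noteq> {}"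
    and two: "\<And>w. w \<in> W \<Longrightarrow> w \<noteq> v \<Longrightarrow>
           \<exists>x\<in>W. \<exists>y\<in>W. x \<noteq> y \<and> (w, x) \<in> parcs G \<and> (w, y) \<in> parcs G"
    and one: "v \<in> W \<Longrightarrow> \<exists>x\<in>W. (v, x) \<in> parcs G"
  shows "\<exists>p. cycle p \<and> 3 \<le> length p"
proof -
  \<comment> \<open>Paths grow at the head of the list, so the exceptional vertex is kept as the last element.\<close>
  define paths where "paths = {xs. vpath xs (with_proj G) \<and> set xs \<subseteq> W \<and> 2 \<le> length xs
      \<and> (v \<in> W \<longrightarrow> last xs = v)}"
  have path_edge: "[x, u] \<in> paths" if "u \<in> W" "x \<in> W" "(u, x) \<in> parcs G" "v \<in> W \<longrightarrow> u = v" for u x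
    using that assms(1) no_loops'[OF that(3)] arcs_symmetric[OF that(3)]
    by (auto simp: paths_def vpath_def vwalk_def)
  have "paths \<noteq> {}"
  proof (cases "v \<in> W")
    case True
    with one obtain x where "x \<in> W" "(v, x) \<in> parcs G" by blast
    with True path_edge[of v x] show ?thesis by blast
  next
    case False
    obtain u where u: "u \<in> W" using assms(2) by blast
    with False two[of u] obtain x where "x \<in> W" "(u, x) \<in> parcs G" by blast
    with u False path_edge[of u x] show ?thesis by blast
  qed
  moreover have "finite paths"
    by (rule finite_subset[OF _ vpaths_finite]) (auto simp: paths_def)
  ultimately obtain p where p: "p \<in> paths" and longest: "\<And>q. q \<in> paths \<Longrightarrow> length q \<le> length p"
    using Max_in[of "length ` paths"] Max_ge[of "length ` paths"] by fastforce
  obtain x y zs where p_eq: "p = x # y # zs"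
    using p unfolding paths_def by (cases p; cases "tl p") auto
  have walk: "vwalk p (with_proj G)" and dist: "distinct p" and sub: "set p \<subseteq> W"
    and end_v: "v \<in> W \<longrightarrow> last p = v"
    using p by (auto simp: paths_def vpath_def)
  have "x \<in> W" "x \<noteq> v" using sub dist end_v by (auto simp: p_eq split: if_splits)
  then obtain z where z: "z \<in> W" "z \<noteq> y" "(x, z) \<in> parcs G"
    using two by metis
  have zx: "(z, x) \<in> parcs G" using z(3) by (rule arcs_symmetric)
  have "z \<in> set p"
  proof (rule ccontr)
    assume "z \<notin> set p"
    with walk dist sub end_v z zx have "z # p \<in> paths"
      by (auto simp: paths_def vpath_def p_eq intro: vwalk_wf_digraph_consI)
    from longest[OF this] show False by simp
  qed
  moreover have "z \<noteq> x" using no_loops'[OF z(3)] by simp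
  ultimately have "z \<in> set zs" using z(2) by (simp add: p_eq)
  \<comment> \<open>The cycle runs along the path from \<open>x\<close> to \<open>z\<close> and returns by the edge from \<open>z\<close> to \<open>x\<close>.\<close>
  then obtain as bs where zs: "zs = as @ z # bs" by (auto dest: split_list)
  have "vwalk ((x # y # as @ [z]) @ bs) (with_proj G)" using walk by (simp add: p_eq zs)
  then have "vwalk (x # y # as @ [z]) (with_proj G)" by (rule vwalkI_append_l[rotated]) simp
  moreover have "set (vwalk_arcs (x # y # as @ [z, x])) \<subseteq>
      insert (z, x) (set (vwalk_arcs (x # y # as @ [z])))"
    using set_vwalk_arcs_snoc[of "x # y # as @ [z]" x] by simp
  ultimately have "vwalk (x # y # as @ [z, x]) (with_proj G)"
    using zx by (auto simp: vwalk_def)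
  from awalk_vwalk_arcs[OF this]
  have "awalk x (vwalk_arcs (x # y # as @ [z, x])) x"
    "awalk_verts x (vwalk_arcs (x # y # as @ [z, x])) = x # y # as @ [z, x]"
    by simp_all
  moreover have "distinct (y # as @ [z, x])" using dist by (auto simp: p_eq zs)
  ultimately have "cycle (vwalk_arcs (x # y # as @ [z, x]))"
    unfolding cycle_def by (intro exI[of _ x]) auto
  moreover have "3 \<le> length (vwalk_arcs (x # y # as @ [z, x]))"
    using vwalk_length_simp[of "x # y # as @ [z, x]"] unfolding vwalk_length_def by simp
  ultimately show ?thesis by blast
qed

text \<open>
  Each vertex of a cycle is adjacent to its successor and to its predecessor, and these differ as
  soon as the cycle has length at least three.
\<close>

lemma (in pair_graph) min_degree_two_cycle:
  assumes "cycle p" "3 \<le> length p"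
  shows "min_degree_two (parcs G) (fst ` set p)"
proof -
  obtain u where walk: "awalk u p u" and dist: "distinct (tl (awalk_verts u p))"
    using assms(1) by (auto simp: cycle_def)
  have dist: "distinct (map snd p)"
    using walk dist assms(2) awalk_verts_conv'[of u p u] by (auto simp: awalk_def split: if_splits)
  show ?thesis
  proof (rule min_degree_twoI)
    show "fst (hd p) \<in> fst ` set p" using assms(2) by (cases p) auto
  next
    fix w assume "w \<in> fst ` set p"
    then obtain x where "(w, x) \<in> set p" by auto
    \<comment> \<open>Rotating the cycle to start with the arc from \<open>w\<close> to \<open>x\<close> makes the predecessor of \<open>w\<close>
      the tail of the last arc.\<close>
    then obtain p1 p2 where p: "p = p1 @ (w, x) # p2" by (auto dest: split_list)
    have parts: "awalk u p1 w" "(w, x) \<in> parcs G" "awalk x p2 u"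
      using walk by (auto simp: p awalk_Cons_iff)
    then have return: "awalk x (p2 @ p1) w" by auto
    have "p2 @ p1 \<noteq> []" "length (p2 @ p1) \<ge> 2" using assms(2) by (auto simp: p)
    then obtain q e where q: "p2 @ p1 = q @ [e]" by (metis rev_exhaust)
    then have "q \<noteq> []" using \<open>length (p2 @ p1) \<ge> 2\<close> by auto
    obtain y where e: "e = (y, w)" and walk_q: "awalk x q y" and "(y, w) \<in> parcs G"
      using return unfolding q by (cases e) (auto simp: awalk_Cons_iff awalk_Nil_iff)
    have set_q: "set q \<subseteq> set (p2 @ p1)" "e \<in> set (p2 @ p1)" unfolding q by auto
    have "y \<noteq> x"
    proof
      assume "y = x"
      with walk_q \<open>q \<noteq> []\<close> have "snd (last q) = x"
        by (cases q rule: rev_cases) (auto simp: awalk_Cons_iff awalk_Nil_iff)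
      then have "x \<in> snd ` set (p2 @ p1)" using \<open>q \<noteq> []\<close> set_q last_in_set by blast
      then show False using dist by (auto simp: p)
    qed
    moreover have "x \<in> fst ` set p"
    proof -
      obtain f where "f \<in> set q" "fst f = x"
        using walk_q \<open>q \<noteq> []\<close> by (cases q) (auto simp: awalk_Cons_iff)
      then show ?thesis using set_q by (auto simp: p)
    qed
    moreover have "y \<in> fst ` set p" using set_q by (force simp: p e)
    moreover have "(w, y) \<in> parcs G" using \<open>(y, w) \<in> parcs G\<close> by (rule arcs_symmetric)
    ultimately show "\<exists>x\<in>fst ` set p. \<exists>y\<in>fst ` set p. x \<noteq> y \<and> (w, x) \<in> parcs G \<and> (w, y) \<in> parcs G"
      using parts(2) by blast
  qed
qed

lemma (in pair_graph) undirected_forest_iff: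
  "undirected_forest (with_proj G) \<longleftrightarrow> \<not> (\<exists>W\<subseteq>pverts G. min_degree_two (parcs G) W)"
proof -
  have "\<exists>p. cycle p \<and> 3 \<le> length p" if W: "W \<subseteq> pverts G" "min_degree_two (parcs G) W" for W
  proof -
    have two: "\<exists>x\<in>W. \<exists>y\<in>W. x \<noteq> y \<and> (w, x) \<in> parcs G \<and> (w, y) \<in> parcs G"
      if "w \<in> W" for w
      using W(2) that by (auto simp: min_degree_two_def)
    \<comment> \<open>Every vertex has two neighbours, so any choice of the exceptional vertex is admissible.\<close>
    show ?thesis
      by (rule cycle_if_min_degree_two_except[OF W(1), where v = undefined])
        (use two W(2) in \<open>auto simp: min_degree_two_def\<close>)
  qed
  moreover have "fst ` set p \<subseteq> pverts G" if "cycle p" for p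
    using that in_arcsD1 by (fastforce simp: cycle_def awalk_def)
  ultimately show ?thesis
    unfolding undirected_forest_def using min_degree_two_cycle pair_graphD_graph by metis
qed

lemma induce_subgraph_with_proj:
  "with_proj G \<restriction> V = with_proj \<lparr>pverts = V, parcs = parcs G \<inter> V \<times> V\<rparr>"
  by (auto simp: induce_subgraph_def with_proj_def)

lemma decycling_set_iff:
  assumes "pair_graph G"
  shows "decycling_set (with_proj G) S \<longleftrightarrow>
    S \<subseteq> pverts G \<and> \<not> (\<exists>W\<subseteq>pverts G - S. min_degree_two (parcs G) W)"
proof -
  interpret pair_graph G by fact
  let ?V = "pverts G - S"
  let ?H = "\<lparr>pverts = ?V, parcs = parcs G \<inter> ?V \<times> ?V\<rparr>"
  interpret H: pair_graph ?H
    by unfold_locales (auto simp: pair_finite_verts pair_finite_arcs symmetric_def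
        dest: no_loops' arcs_symmetric intro!: symI)
  have "min_degree_two (parcs G \<inter> ?V \<times> ?V) W \<longleftrightarrow> min_degree_two (parcs G) W" if "W \<subseteq> ?V" for W
    using that unfolding min_degree_two_def by blast
  then show ?thesis
    unfolding decycling_set_def induce_subgraph_with_proj with_proj_simps H.undirected_forest_iff
    by auto
qed

section \<open>Connected graphs and a rectangle in the product\<close>

text \<open>
  The set \<open>P\<close> is the vertex set of a path from \<open>u\<close> to \<open>v\<close>. Only the degrees in \<open>P\<close> are recorded,
  as these are what a set of minimum degree two in the product is assembled from.
\<close>

lemma (in pair_graph) connecting_path_verts:
  assumes "Digraph_Component.connected (with_proj G)"
    and "u \<in> pverts G" "v \<in> pverts G" "u \<noteq> v"
  obtains P where "P \<subseteq> pverts G" "u \<in> P" "v \<in> P"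
    "\<And>w. w \<in> P \<Longrightarrow> \<exists>x\<in>P. (w, x) \<in> parcs G"
    "\<And>w. w \<in> P \<Longrightarrow> w \<noteq> u \<Longrightarrow> w \<noteq> v \<Longrightarrow>
       \<exists>x\<in>P. \<exists>y\<in>P. x \<noteq> y \<and> (w, x) \<in> parcs G \<and> (w, y) \<in> parcs G"
proof -
  have "strongly_connected (with_proj G)"
    by (rule symmetric_connected_imp_strongly_connected[OF pair_sym_arcs assms(1)])
  then have "u \<rightarrow>\<^sup>*\<^bsub>with_proj G\<^esub> v" using assms(2,3) by (auto elim: strongly_connectedE)
  then obtain q where q: "vpath q (with_proj G)" "hd q = u" "last q = v"
    using reachable_vpath_conv by blast
  then have ne: "q \<noteq> []" by (auto simp: vpath_def vwalk_def)
  have arcs: "set (vwalk_arcs q) \<subseteq> parcs G" and dist: "distinct q" and sub: "set q \<subseteq> pverts G"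
    using q(1) by (auto simp: vpath_def vwalk_def)
  have pred: "(w, last xs) \<in> parcs G" if "q = xs @ w # ys" "xs \<noteq> []" for w xs ys
  proof (rule arcs_symmetric)
    show "(last xs, w) \<in> parcs G" using arcs that by (auto simp: vwalk_arcs_append)
  qed
  have succ: "(w, hd ys) \<in> parcs G" if "q = xs @ w # ys" "ys \<noteq> []" for w xs ys
    using arcs that set_vwalk_arcs_append2[of "w # ys" xs] by auto
  show thesis
  proof (rule that)
    show "set q \<subseteq> pverts G" by fact
    show "u \<in> set q" "v \<in> set q" using q ne by auto
  next
    fix w assume "w \<in> set q"
    then obtain xs ys where split: "q = xs @ w # ys" by (auto dest: split_list)
    have "xs \<noteq> [] \<or> ys \<noteq> []" using split q assms(4) by auto
    then show "\<exists>x\<in>set q. (w, x) \<in> parcs G"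
    proof
      assume "xs \<noteq> []"
      with pred[OF split] show ?thesis by (intro bexI[of _ "last xs"]) (auto simp: split)
    next
      assume "ys \<noteq> []"
      with succ[OF split] show ?thesis by (intro bexI[of _ "hd ys"]) (auto simp: split)
    qed
  next
    fix w assume "w \<in> set q" "w \<noteq> u" "w \<noteq> v"
    then obtain xs ys where split: "q = xs @ w # ys" by (auto dest: split_list)
    have ne: "xs \<noteq> []" "ys \<noteq> []" using split q \<open>w \<noteq> u\<close> \<open>w \<noteq> v\<close> by auto
    have "last xs \<in> set xs" "hd ys \<in> set ys" using ne by auto
    moreover from this have "last xs \<noteq> hd ys" using dist unfolding split by auto
    ultimately show "\<exists>x\<in>set q. \<exists>y\<in>set q. x \<noteq> y \<and> (w, x) \<in> parcs G \<and> (w, y) \<in> parcs G"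
      using pred[OF split ne(1)] succ[OF split ne(2)]
      by (intro bexI[of _ "last xs"] bexI[of _ "hd ys"]) (auto simp: split)
  qed
qed

lemma (in pair_graph) connected_neighbour:
  assumes "Digraph_Component.connected (with_proj G)" "2 \<le> card (pverts G)" "u \<in> pverts G"
  obtains x where "x \<in> pverts G" "x \<noteq> u" "(u, x) \<in> parcs G"
proof -
  have "\<not> pverts G \<subseteq> {u}" using assms(2) card_mono[of "{u}" "pverts G"] by auto
  then obtain v where "v \<in> pverts G" "v \<noteq> u" by blast
  then obtain P where "u \<in> P" "\<And>w. w \<in> P \<Longrightarrow> \<exists>x\<in>P. (w, x) \<in> parcs G"
    using connecting_path_verts[OF assms(1,3)] by metis
  then obtain x where "(u, x) \<in> parcs G" by blast
  then show thesis using that no_loops'[of u x] in_arcsD2[of u x] by blast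
qed

lemma parcs_cartesian_product_iff:
  "((g, h), (g', h')) \<in> parcs (G \<box> H) \<longleftrightarrow>
     g \<in> pverts G \<and> g = g' \<and> (h, h') \<in> parcs H \<or> (g, g') \<in> parcs G \<and> h \<in> pverts H \<and> h = h'"
  by (auto simp: cartesian_product_def)

lemma pverts_cartesian_product [simp]: "pverts (G \<box> H) = pverts G \<times> pverts H"
  by (simp add: cartesian_product_def)

text \<open>
  A path \<open>P\<close> from \<open>g1\<close> to \<open>g2\<close> and a path \<open>Q\<close> from \<open>h1\<close> to \<open>h2\<close> give the rectangle with the two
  sides \<open>P \<times> {h1}\<close>, \<open>P \<times> {h2}\<close> and the two sides \<open>{g1} \<times> Q\<close>, \<open>{g2} \<times> Q\<close>. An interior vertex of a
  side has two neighbours on that side, and a corner has one on each of the two sides that meet there.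
\<close>

lemma min_degree_two_rectangle:
  assumes G: "pair_graph G" "Digraph_Component.connected (with_proj G)"
    and H: "pair_graph H" "Digraph_Component.connected (with_proj H)"
    and g: "g1 \<in> pverts G" "g2 \<in> pverts G" "g1 \<noteq> g2"
    and h: "h1 \<in> pverts H" "h2 \<in> pverts H" "h1 \<noteq> h2"
  obtains W where "W \<subseteq> {g1, g2} \<times> pverts H \<union> pverts G \<times> {h1, h2}"
    "min_degree_two (parcs (G \<box> H)) W"
proof -
  interpret G: pair_graph G by fact
  interpret H: pair_graph H by fact
  obtain P where P: "P \<subseteq> pverts G" "g1 \<in> P" "g2 \<in> P"
    and P1: "\<And>w. w \<in> P \<Longrightarrow> \<exists>x\<in>P. (w, x) \<in> parcs G"
    and P2: "\<And>w. w \<in> P \<Longrightarrow> w \<noteq> g1 \<Longrightarrow> w \<noteq> g2 \<Longrightarrow>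
       \<exists>x\<in>P. \<exists>y\<in>P. x \<noteq> y \<and> (w, x) \<in> parcs G \<and> (w, y) \<in> parcs G"
    using G.connecting_path_verts[OF G(2) g] by metis
  obtain Q where Q: "Q \<subseteq> pverts H" "h1 \<in> Q" "h2 \<in> Q"
    and Q1: "\<And>w. w \<in> Q \<Longrightarrow> \<exists>x\<in>Q. (w, x) \<in> parcs H"
    and Q2: "\<And>w. w \<in> Q \<Longrightarrow> w \<noteq> h1 \<Longrightarrow> w \<noteq> h2 \<Longrightarrow>
       \<exists>x\<in>Q. \<exists>y\<in>Q. x \<noteq> y \<and> (w, x) \<in> parcs H \<and> (w, y) \<in> parcs H"
    using H.connecting_path_verts[OF H(2) h] by metis
  define W where "W = P \<times> {h1, h2} \<union> {g1, g2} \<times> Q"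
  have "min_degree_two (parcs (G \<box> H)) W"
  proof (rule min_degree_twoI)
    show "(g1, h1) \<in> W" using P by (simp add: W_def)
  next
    fix w assume "w \<in> W"
    then consider (corner) p q where "w = (p, q)" "p \<in> {g1, g2}" "q \<in> {h1, h2}"
      | (column) p q where "w = (p, q)" "p \<in> P" "p \<notin> {g1, g2}" "q \<in> {h1, h2}"
      | (row) p q where "w = (p, q)" "p \<in> {g1, g2}" "q \<in> Q" "q \<notin> {h1, h2}"
      unfolding W_def by blast
    then show "\<exists>x\<in>W. \<exists>y\<in>W. x \<noteq> y \<and> (w, x) \<in> parcs (G \<box> H) \<and> (w, y) \<in> parcs (G \<box> H)"
    proof cases
      case corner
      then have "p \<in> P" "q \<in> Q" using P Q by auto
      then obtain x y where "x \<in> P" "(p, x) \<in> parcs G" "y \<in> Q" "(q, y) \<in> parcs H"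
        using P1 Q1 by blast
      with corner \<open>p \<in> P\<close> \<open>q \<in> Q\<close> P(1) Q(1) G.no_loops'[of p x] show ?thesis
        by (intro bexI[of _ "(x, q)"] bexI[of _ "(p, y)"])
          (auto simp: W_def parcs_cartesian_product_iff)
    next
      case column
      then obtain x y where "x \<in> P" "y \<in> P" "x \<noteq> y" "(p, x) \<in> parcs G" "(p, y) \<in> parcs G"
        using P2[of p] by auto
      with column Q h show ?thesis
        by (intro bexI[of _ "(x, q)"] bexI[of _ "(y, q)"])
          (auto simp: W_def parcs_cartesian_product_iff)
    next
      case row
      then obtain x y where "x \<in> Q" "y \<in> Q" "x \<noteq> y" "(q, x) \<in> parcs H" "(q, y) \<in> parcs H"
        using Q2[of q] by auto
      with row g show ?thesis
        by (intro bexI[of _ "(p, x)"] bexI[of _ "(p, y)"])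
          (auto simp: W_def parcs_cartesian_product_iff)
    qed
  qed
  moreover have "W \<subseteq> {g1, g2} \<times> pverts H \<union> pverts G \<times> {h1, h2}"
    using P(1) Q(1) by (auto simp: W_def)
  ultimately show thesis using that by blast
qed

section \<open>Lower bound and the structure of small decycling sets\<close>

lemma card_ge_two_obtain:
  assumes "2 \<le> card A"
  obtains x y where "x \<in> A" "y \<in> A" "x \<noteq> y"
proof -
  obtain B where "B \<subseteq> A" "card B = 2"
    using obtain_subset_with_card_n[OF assms] by blast
  then show thesis using that by (auto simp: card_2_iff)
qed

text \<open>
  Two missed rows and two missed columns would contain a rectangle avoiding \<open>S\<close>.
\<close>

lemma decycling_set_meets_fibres:
  assumes G: "pair_graph G" "Digraph_Component.connected (with_proj G)"
    and H: "pair_graph H" "Digraph_Component.connected (with_proj H)"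
    and S: "decycling_set (with_proj (G \<box> H)) S"
  shows "card (pverts G - fst ` S) < 2 \<or> card (pverts H - snd ` S) < 2"
proof (rule ccontr)
  assume "\<not> ?thesis"
  then have "2 \<le> card (pverts G - fst ` S)" "2 \<le> card (pverts H - snd ` S)" by auto
  then obtain g1 g2 h1 h2 where
    g: "g1 \<in> pverts G - fst ` S" "g2 \<in> pverts G - fst ` S" "g1 \<noteq> g2" and
    h: "h1 \<in> pverts H - snd ` S" "h2 \<in> pverts H - snd ` S" "h1 \<noteq> h2"
    using card_ge_two_obtain by metis
  then obtain W where W: "W \<subseteq> {g1, g2} \<times> pverts H \<union> pverts G \<times> {h1, h2}"
    "min_degree_two (parcs (G \<box> H)) W"
    using min_degree_two_rectangle[OF G H, of g1 g2 h1 h2] by auto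
  moreover have "W \<subseteq> pverts (G \<box> H) - S" using W(1) g h by (auto simp: rev_image_eqI)
  ultimately show False
    using S decycling_set_iff[OF pair_graph_cartesian_product[OF G(1) H(1)]] by blast
qed

lemma card_diff_image_ge:
  assumes "finite S" "finite A"
  shows "card A - card S \<le> card (A - f ` S)"
proof -
  have "card A - card (f ` S) \<le> card (A - f ` S)"
    using assms by (simp add: diff_card_le_card_Diff)
  then show ?thesis using card_image_le[OF assms(1), of f] by linarith
qed

lemma decycling_set_card_ge:
  assumes G: "pair_graph G" "Digraph_Component.connected (with_proj G)"
    and H: "pair_graph H" "Digraph_Component.connected (with_proj H)"
    and le: "card (pverts G) \<le> card (pverts H)"
    and S: "decycling_set (with_proj (G \<box> H)) S"
  shows "card (pverts G) - 1 \<le> card S"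
proof -
  interpret G: pair_graph G by fact
  interpret H: pair_graph H by fact
  have "finite S"
    using S finite_subset[of S "pverts G \<times> pverts H"]
    by (auto simp: decycling_set_def G.pair_finite_verts H.pair_finite_verts)
  then have "card (pverts G) - card S \<le> card (pverts G - fst ` S)"
    "card (pverts H) - card S \<le> card (pverts H - snd ` S)"
    by (simp_all add: card_diff_image_ge G.pair_finite_verts H.pair_finite_verts)
  with le decycling_set_meets_fibres[OF G H S] show ?thesis by linarith
qed

definition star_centre :: "'a pair_pre_digraph \<Rightarrow> 'a \<Rightarrow> bool" where
  "star_centre G a \<longleftrightarrow> a \<in> pverts G \<and> (\<forall>(x, y) \<in> parcs G. x = a \<or> y = a)"

text \<open>
  By counting, \<open>S\<close> misses one row \<open>g0\<close> and has one element in every other row. In the row of a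
  neighbour \<open>g1\<close> of \<open>g0\<close>, the single deleted vertex has to destroy all the 4-cycles that the edges of
  \<open>H\<close> span between these two rows, so its second coordinate lies on every edge of \<open>H\<close>.
\<close>

lemma star_centre_if_decycling_set:
  assumes G: "pair_graph G" "Digraph_Component.connected (with_proj G)"
    and H: "pair_graph H"
    and S: "decycling_set (with_proj (G \<box> H)) S" "card S = card (pverts G) - 1"
    and two: "2 \<le> card (pverts G)"
    and free: "card (pverts G - fst ` S) < 2"
  shows "\<exists>a. star_centre H a"
proof -
  interpret G: pair_graph G by fact
  interpret H: pair_graph H by fact
  interpret GH: pair_graph "G \<box> H" by (rule pair_graph_cartesian_product) fact+
  have sub: "S \<subseteq> pverts G \<times> pverts H" using S(1) by (simp add: decycling_set_def)
  then have fin: "finite S" 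
    by (auto intro: finite_subset simp: G.pair_finite_verts H.pair_finite_verts)
  have "card (pverts G - fst ` S) = card (pverts G) - card (fst ` S)"
    using sub fin by (intro card_Diff_subset) auto
  \<comment> \<open>At least \<open>card (pverts G) - 1\<close> rows are met by as many elements, hence each of them once.\<close>
  then have card_fst: "card (fst ` S) = card S"
    using card_image_le[OF fin, of fst] free S(2) two by linarith
  then have inj: "inj_on fst S" by (rule eq_card_imp_inj_on[OF fin])
  have "fst ` S \<noteq> pverts G" using card_fst S(2) two by auto
  then obtain g0 where g0: "g0 \<in> pverts G" "g0 \<notin> fst ` S" using sub by auto
  then obtain g1 where g1: "g1 \<in> pverts G" "g1 \<noteq> g0" "(g0, g1) \<in> parcs G"
    using G.connected_neighbour[OF G(2) two] by blast
  have "g1 \<in> fst ` S"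
  proof (rule ccontr)
    assume "g1 \<notin> fst ` S"
    with g0 g1 have "card {g0, g1} \<le> card (pverts G - fst ` S)"
      by (intro card_mono) (auto simp: G.pair_finite_verts)
    with free g1 show False by simp
  qed
  then obtain a where a: "(g1, a) \<in> S" by auto
  have uniq: "h = a" if "(g1, h) \<in> S" for h using inj_onD[OF inj _ that a] by simp
  have "x = a \<or> y = a" if xy: "(x, y) \<in> parcs H" for x y
  proof (rule ccontr)
    assume "\<not> (x = a \<or> y = a)"
    then have "{g0, g1} \<times> {x, y} \<subseteq> pverts (G \<box> H) - S"
      using uniq g0 g1 H.wellformed'[OF xy] by (auto simp: rev_image_eqI)
    moreover have "min_degree_two (parcs (G \<box> H)) ({g0, g1} \<times> {x, y})"
    proof (rule min_degree_twoI)
      show "(g0, x) \<in> {g0, g1} \<times> {x, y}" by simp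
    next
      fix w assume "w \<in> {g0, g1} \<times> {x, y}"
      then obtain g h where w: "w = (g, h)" "g \<in> {g0, g1}" "h \<in> {x, y}" by auto
      have "(g1, g0) \<in> parcs G" "(y, x) \<in> parcs H"
        using g1 xy by (auto intro: G.arcs_symmetric H.arcs_symmetric)
      then show "\<exists>u\<in>{g0, g1} \<times> {x, y}. \<exists>v\<in>{g0, g1} \<times> {x, y}.
          u \<noteq> v \<and> (w, u) \<in> parcs (G \<box> H) \<and> (w, v) \<in> parcs (G \<box> H)"
        using w g0 g1 xy H.wellformed'[OF xy] H.no_loops'[OF xy]
        by (intro bexI[of _ "(if g = g0 then g1 else g0, h)"]
            bexI[of _ "(g, if h = x then y else x)"])
          (auto simp: parcs_cartesian_product_iff split: if_splits)
    qed
    ultimately show False using S(1) decycling_set_iff[OF GH.pair_graph] by blast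
  qed
  then show ?thesis using a sub by (auto simp: star_centre_def)
qed

text \<open>
  The exchange of coordinates is an isomorphism of the two products, so it carries sets of minimum
  degree two to sets of minimum degree two.
\<close>

lemma decycling_set_swap:
  assumes G: "pair_graph G" and H: "pair_graph H" and S: "decycling_set (with_proj (G \<box> H)) S"
  shows "decycling_set (with_proj (H \<box> G)) (prod.swap ` S)"
proof -
  have core: "min_degree_two (parcs (G \<box> H)) (prod.swap ` W)" if W: "min_degree_two (parcs (H \<box> G)) W" for W
  proof -
    have arcs: "(prod.swap u, prod.swap v) \<in> parcs (G \<box> H)" if "(u, v) \<in> parcs (H \<box> G)" for u v
      using that by (cases u; cases v) (auto simp: parcs_cartesian_product_iff)
    show ?thesis
      unfolding min_degree_two_def ball_simps
    proof (intro conjI ballI)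
      show "prod.swap ` W \<noteq> {}" using W by (simp add: min_degree_two_def)
    next
      fix w assume "w \<in> W"
      then obtain x y where "x \<in> W" "y \<in> W" "x \<noteq> y"
        "(w, x) \<in> parcs (H \<box> G)" "(w, y) \<in> parcs (H \<box> G)"
        using W unfolding min_degree_two_def by blast
      then show "\<exists>x\<in>prod.swap ` W. \<exists>y\<in>prod.swap ` W. x \<noteq> y \<and>
          (prod.swap w, x) \<in> parcs (G \<box> H) \<and> (prod.swap w, y) \<in> parcs (G \<box> H)"
        using arcs[of w x] arcs[of w y] inj_eq[OF inj_swap] by blast
    qed
  qed
  have avoid: "prod.swap ` W \<subseteq> pverts (G \<box> H) - S"
    if "W \<subseteq> pverts (H \<box> G) - prod.swap ` S" for W
    using that by (force simp: image_iff)
  have "prod.swap ` S \<subseteq> pverts (H \<box> G)"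
    using S by (auto simp: decycling_set_def)
  moreover have "\<not> min_degree_two (parcs (H \<box> G)) W"
    if "W \<subseteq> pverts (H \<box> G) - prod.swap ` S" for W
    using S core[of W] avoid[OF that]
    unfolding decycling_set_iff[OF pair_graph_cartesian_product[OF G H]] by metis
  ultimately show ?thesis
    unfolding decycling_set_iff[OF pair_graph_cartesian_product[OF H G]] by simp
qed

section \<open>Stars\<close>

text \<open>
  In a connected graph with at least two vertices each vertex has a neighbour; if all edges contain
  \<open>a\<close>, this neighbour is \<open>a\<close> for each vertex other than \<open>a\<close>. So the edges are exactly those of the
  star, and any bijection from the other vertices to the leaves extends to an isomorphism.
\<close>

lemma star_iso_iff:
  assumes H: "pair_graph H" "Digraph_Component.connected (with_proj H)"
    and two: "2 \<le> card (pverts H)"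
  shows "with_proj H \<cong> with_proj (star (card (pverts H))) \<longleftrightarrow> (\<exists>a. star_centre H a)"
proof -
  let ?n = "card (pverts H)"
  interpret H: pair_graph H by fact
  show ?thesis
  proof
    assume "with_proj H \<cong> with_proj (star ?n)"
    then obtain f where f: "H.digraph_isomorphism f" "with_proj (star ?n) = app_iso f (with_proj H)"
      by (auto simp: digraph_iso_def)
    have verts: "iso_verts f ` pverts H = {..<?n}"
      using arg_cong[OF f(2), of verts] by (simp add: star_def)
    have arcs: "iso_arcs f ` parcs H = parcs (star ?n)"
      using arg_cong[OF f(2), of arcs] by simp
    have ends: "iso_tail f = fst" "iso_head f = snd"
      using arg_cong[OF f(2), of tail] arg_cong[OF f(2), of head] by simp_all
    have "0 \<in> iso_verts f ` pverts H" using verts two by auto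
    then obtain a where a: "a \<in> pverts H" "iso_verts f a = 0" by force
    have "x = a \<or> y = a" if xy: "(x, y) \<in> parcs H" for x y
    proof -
      have "iso_arcs f (x, y) \<in> parcs (star ?n)" using xy arcs by blast
      then have "iso_verts f x = 0 \<or> iso_verts f y = 0"
        using H.iso_verts_tail[OF f(1) xy] H.iso_verts_head[OF f(1) xy]
        by (auto simp: ends star_def)
      then show ?thesis
        using a H.wellformed'[OF xy] H.iso_verts_eq_iff[OF f(1)] by metis
    qed
    with a show "\<exists>a. star_centre H a" by (auto simp: star_centre_def)
  next
    assume "\<exists>a. star_centre H a"
    then obtain a where a: "a \<in> pverts H" and centre: "\<And>x y. (x, y) \<in> parcs H \<Longrightarrow> x = a \<or> y = a"
      by (auto simp: star_centre_def)
    have "(v, a) \<in> parcs H" if "v \<in> pverts H - {a}" for v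
      using H.connected_neighbour[OF H(2) two] that centre by blast
    then have arcs: "parcs H = {a} \<times> (pverts H - {a}) \<union> (pverts H - {a}) \<times> {a}"
      using centre H.wellformed' H.no_loops' H.arcs_symmetric by fast
    have "card (pverts H - {a}) = card {1..<?n}"
      using a by simp
    then obtain k where k: "bij_betw k (pverts H - {a}) {1..<?n}"
      using finite_same_card_bij[of "pverts H - {a}" "{1..<?n}"] H.pair_finite_verts by auto
    define h where "h = (\<lambda>v. if v = a then 0 else k v)"
    have img: "h ` (pverts H - {a}) = {1..<?n}"
      using k by (auto simp: h_def bij_betw_def)
    have "k v \<noteq> 0" if "v \<in> pverts H - {a}" for v
      using bij_betwE[OF k] that by (metis atLeastLessThan_iff not_one_le_zero)
    then have inj: "inj_on h (pverts H)"
      using k by (auto simp: h_def bij_betw_def inj_on_def)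
    have h_a: "h ` {a} = {0}" by (simp add: h_def)
    have "pverts H = insert a (pverts H - {a})" using a by auto
    then have "h ` pverts H = insert (h a) (h ` (pverts H - {a}))" by (metis image_insert)
    then have "h ` pverts H = insert 0 {1..<?n}" by (simp only: img) (simp add: h_def)
    then have verts: "h ` pverts H = {..<?n}"
      using two by auto
    have h_arcs: "map_prod h h ` parcs H = parcs (star ?n)"
      using map_prod_surj_on[OF h_a img] map_prod_surj_on[OF img h_a]
      by (simp add: arcs image_Un star_def)
    define f where "f = \<lparr>iso_verts = h, iso_arcs = map_prod h h, iso_head = snd, iso_tail = fst\<rparr>"
    have "inj_on (map_prod h h) (parcs H)"
      by (rule inj_on_subset[OF map_prod_inj_on[OF inj inj]]) (auto dest: H.wellformed')
    then have "H.digraph_isomorphism f"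
      unfolding H.digraph_isomorphism_def using inj H.wf_digraph by (auto simp: f_def)
    moreover have "with_proj (star ?n) = app_iso f (with_proj H)"
      using h_arcs verts by (simp add: with_proj_def app_iso_def f_def star_def)
    ultimately show "with_proj H \<cong> with_proj (star ?n)"
      unfolding digraph_iso_def by blast
  qed
qed

text \<open>
  A set \<open>W\<close> of minimum degree two outside the deleted vertices contains a vertex over some leaf \<open>h\<close>
  of the star. The part \<open>L\<close> of \<open>W\<close> over \<open>h\<close> is joined to the rest of \<open>W\<close> at most by the edge from
  \<open>(v, h)\<close> to \<open>(v, a)\<close>. So in \<open>G\<close> each vertex of \<open>L\<close> other than \<open>v\<close> has two neighbours in \<open>L\<close>, and \<open>v\<close>,
  if it is in \<open>L\<close>, has at least one. A forest contains no such set.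
\<close>

lemma decycling_set_if_star_centre:
  assumes G: "pair_graph G" "undirected_forest (with_proj G)"
    and H: "pair_graph H" and a: "star_centre H a"
  shows "decycling_set (with_proj (G \<box> H)) ((pverts G - {v}) \<times> {a})"
proof -
  interpret G: pair_graph G by fact
  interpret H: pair_graph H by fact
  let ?S = "(pverts G - {v}) \<times> {a}"
  have "\<not> min_degree_two (parcs (G \<box> H)) W" if W: "W \<subseteq> pverts (G \<box> H) - ?S" for W
  proof
    assume "min_degree_two (parcs (G \<box> H)) W"
    then have ne: "W \<noteq> {}" and two: "\<And>w. w \<in> W \<Longrightarrow> \<exists>x\<in>W. \<exists>y\<in>W. x \<noteq> y \<and>
        (w, x) \<in> parcs (G \<box> H) \<and> (w, y) \<in> parcs (G \<box> H)"
      by (auto simp: min_degree_two_def)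
    have at_centre: "g = v" if "(g, a) \<in> W" for g using that W by auto
    have nbr: "g' = v \<and> g = v \<and> h' = a \<or> h' = h \<and> (g, g') \<in> parcs G"
      if "(g', h') \<in> W" "((g, h), (g', h')) \<in> parcs (G \<box> H)" "h \<noteq> a" for g h g' h'
      using that at_centre a by (auto simp: parcs_cartesian_product_iff star_centre_def)
    have "\<exists>g h. (g, h) \<in> W \<and> h \<noteq> a"
    proof (rule ccontr)
      assume "\<not> ?thesis"
      then have "w = (v, a)" if "w \<in> W" for w using that at_centre by (cases w) auto
      then have "\<And>x y. x \<in> W \<Longrightarrow> y \<in> W \<Longrightarrow> x = y" by metis
      with ne two show False by blast
    qed
    then obtain g0 h where h: "(g0, h) \<in> W" "h \<noteq> a" by blast
    define L where "L = {g. (g, h) \<in> W}"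
    have L: "L \<subseteq> pverts G" "L \<noteq> {}" using W h by (auto simp: L_def)
    have L2: "\<exists>x\<in>L. \<exists>y\<in>L. x \<noteq> y \<and> (g, x) \<in> parcs G \<and> (g, y) \<in> parcs G" if "g \<in> L" "g \<noteq> v" for g
    proof -
      have "(g, h) \<in> W" using that by (simp add: L_def)
      from two[OF this] obtain x1 x2 y1 y2 where "(x1, x2) \<in> W" "(y1, y2) \<in> W"
        "(x1, x2) \<noteq> (y1, y2)" "((g, h), (x1, x2)) \<in> parcs (G \<box> H)" "((g, h), (y1, y2)) \<in> parcs (G \<box> H)"
        by auto
      with nbr[of x1 x2 g h] nbr[of y1 y2 g h] h(2) that show ?thesis by (auto simp: L_def)
    qed
    have L1: "\<exists>x\<in>L. (v, x) \<in> parcs G" if "v \<in> L"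
    proof -
      have "(v, h) \<in> W" using that by (simp add: L_def)
      from two[OF this] obtain x1 x2 y1 y2 where "(x1, x2) \<in> W" "(y1, y2) \<in> W"
        "(x1, x2) \<noteq> (y1, y2)" "((v, h), (x1, x2)) \<in> parcs (G \<box> H)" "((v, h), (y1, y2)) \<in> parcs (G \<box> H)"
        by auto
      with nbr[of x1 x2 v h] nbr[of y1 y2 v h] h(2) that show ?thesis by (auto simp: L_def)
    qed
    have "\<exists>p. G.cycle p \<and> 3 \<le> length p"
      by (rule G.cycle_if_min_degree_two_except[OF L L2 L1])
    then show False using G(2) by (auto simp: undirected_forest_def)
  qed
  moreover have "?S \<subseteq> pverts (G \<box> H)" using a by (auto simp: star_centre_def)
  ultimately show ?thesis
    unfolding decycling_set_iff[OF pair_graph_cartesian_product[OF G(1) H]] by blast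
qed

section \<open>The decycling number of a product of trees\<close>

lemma decycling_number_eq_iff:
  assumes G: "pair_graph G" "Digraph_Component.connected (with_proj G)"
    and H: "pair_graph H" "Digraph_Component.connected (with_proj H)"
    and le: "card (pverts G) \<le> card (pverts H)"
  shows "\<nabla> (with_proj (G \<box> H)) = card (pverts G) - 1 \<longleftrightarrow>
    (\<exists>S. decycling_set (with_proj (G \<box> H)) S \<and> card S = card (pverts G) - 1)"
proof -
  interpret GH: graph "with_proj (G \<box> H)"
    using pair_graph_cartesian_product[OF G(1) H(1)] by (rule pair_graph.pair_graphD_graph)
  show ?thesis
    using GH.decycling_number_attained GH.decycling_number_le decycling_set_card_ge[OF G H le]
    by (metis le_antisym)
qed

theorem theorem3p3:
  fixes T :: "'a pair_pre_digraph" and T' :: "'b pair_pre_digraph" and n n' :: nat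
  assumes "undirected_tree (with_proj T)" and "undirected_tree (with_proj T')"
    and "card (pverts T) = n" and "card (pverts T') = n'"
    and "2 \<le> n" and "n \<le> n'"
  shows "(n = n' \<longrightarrow>
           (\<nabla> (with_proj (T \<box> T')) = n - 1 \<longleftrightarrow>
             with_proj T \<cong> with_proj (star n) \<or> with_proj T' \<cong> with_proj (star n')))
       \<and> (n < n' \<longrightarrow>
           (\<nabla> (with_proj (T \<box> T')) = n - 1 \<longleftrightarrow> with_proj T' \<cong> with_proj (star n')))"
proof -
  have T: "pair_graph T" "Digraph_Component.connected (with_proj T)" "undirected_forest (with_proj T)"
    and T': "pair_graph T'" "Digraph_Component.connected (with_proj T')"
      "undirected_forest (with_proj T')"
    using assms(1,2) by (auto simp: undirected_tree_def undirected_forest_def intro: pair_graphI_graph)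
  interpret T: pair_graph T by fact
  interpret T': pair_graph T' by fact
  have number_iff: "\<nabla> (with_proj (T \<box> T')) = n - 1 \<longleftrightarrow>
      (\<exists>S. decycling_set (with_proj (T \<box> T')) S \<and> card S = n - 1)"
    using decycling_number_eq_iff[OF T(1,2) T'(1,2)] assms by simp
  have star_T: "with_proj T \<cong> with_proj (star n) \<longleftrightarrow> (\<exists>a. star_centre T a)"
    and star_T': "with_proj T' \<cong> with_proj (star n') \<longleftrightarrow> (\<exists>a. star_centre T' a)"
    using star_iso_iff[OF T(1,2)] star_iso_iff[OF T'(1,2)] assms by auto
  have number_if_star: "\<nabla> (with_proj (T \<box> T')) = n - 1" if "star_centre T' a" for a
  proof -
    obtain v where "v \<in> pverts T" using assms(3,5) by (metis card.empty ex_in_conv not_numeral_le_zero)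
    then have "card ((pverts T - {v}) \<times> {a}) = n - 1" using assms(3) by (simp add: card_cartesian_product)
    then show ?thesis
      using number_iff decycling_set_if_star_centre[OF T(1,3) T'(1) that, of v] by metis
  qed
  have number_if_star_left: "\<nabla> (with_proj (T \<box> T')) = n - 1" if star: "star_centre T a" "n = n'" for a
  proof -
    obtain v where "v \<in> pverts T'" using assms(3-6) star(2) by (metis card.empty ex_in_conv not_numeral_le_zero)
    then have "card (prod.swap ` ((pverts T' - {v}) \<times> {a})) = n - 1"
      using assms(4) star(2) by (simp add: card_image card_cartesian_product)
    then show ?thesis
      using number_iff decycling_set_swap[OF T'(1) T(1)
          decycling_set_if_star_centre[OF T'(1,3) T(1) star(1), of v]] by metis
  qed
  have star_if_number: "(\<exists>a. star_centre T' a) \<or> n = n' \<and> (\<exists>a. star_centre T a)"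
    if number: "\<nabla> (with_proj (T \<box> T')) = n - 1"
  proof -
    obtain S where S: "decycling_set (with_proj (T \<box> T')) S" "card S = n - 1"
      using number number_iff by blast
    show ?thesis
    proof (cases "card (pverts T - fst ` S) < 2")
      case True
      then show ?thesis
        using star_centre_if_decycling_set[OF T(1,2) T'(1) S(1)] S(2) assms by simp
    next
      case False
      then have few: "card (pverts T' - snd ` S) < 2"
        using decycling_set_meets_fibres[OF T(1,2) T'(1,2) S(1)] by simp
      have "finite S"
        using S(1) finite_subset[of S "pverts T \<times> pverts T'"]
        by (auto simp: decycling_set_def T.pair_finite_verts T'.pair_finite_verts)
      then have "n' - (n - 1) < 2"
        using card_diff_image_ge[of S "pverts T'" snd] few S(2) assms(4) T'.pair_finite_verts by simp
      then have "n = n'" using assms(5,6) by simp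
      moreover have "card (pverts T' - fst ` prod.swap ` S) < 2"
        using few by (simp add: image_comp comp_def)
      ultimately have "\<exists>a. star_centre T a"
        using star_centre_if_decycling_set[OF T'(1,2) T(1) decycling_set_swap[OF T(1) T'(1) S(1)]]
          S(2) assms by (simp add: card_image)
      with \<open>n = n'\<close> show ?thesis by blast
    qed
  qed
  show ?thesis
    unfolding star_T star_T'
    using number_if_star number_if_star_left star_if_number by auto
qed

end
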